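(* Let $\lambda\in\mathbb{R}$, let $\alpha$ be a positive integer and let $m\in\mathbb{N}$ with $m\ge\alpha$. Then \begin{align*} \sum_{k=\alpha}^{m}(k)_{\alpha,\lambda}&=\sum_{k=1}^{m}\binom{m}{k}(k-1)!\Big\{S_{2,\lambda}(\alpha+1,k)+\alpha\lambda\, S_{2,\lambda}(\alpha,k)\Big\}\\ &\quad-\sum_{k=1}^{\alpha-1}\binom{\alpha-1}{k}(k-1)!\Big\{S_{2,\lambda}(\alpha+1,k)+\alpha\lambda\, S_{2,\lambda}(\alpha,k)\Big\}. \end{align*}
   Context: For $\lambda\in\mathbb{R}$, the generalized falling factorial polynomials are $(x)_{0,\lambda}=1$ and $(x)_{n,\lambda}=x(x-\lambda)\cdots(x-(n-1)\lambda)$ for $n\ge1$. The ordinary falling factorial is $(x)_0=1$, $(x)_n=x(x-1)\cdots(x-n+1)$. The degenerate Stirling numbers of the second kind $S_{2,\lambda}(n,k)$ are defined by $(x)_{n,\lambda}=\sum_{k=0}^{n}S_{2,\lambda}(n,k)(x)_{k}$ for all $n\ge 0$, with $S_{2,\lambda}(n,k)=0$ for $k>n$ or $k<0$. *)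

theory Defs
  imports Complex_Main
begin

definition gen_ffact :: "real \<Rightarrow> real \<Rightarrow> nat \<Rightarrow> real" where
  "gen_ffact l x n = (\<Prod>i<n. x - real i * l)"

definition ffact :: "real \<Rightarrow> nat \<Rightarrow> real" where
  "ffact x n = (\<Prod>i<n. x - real i)"

definition is_deg_stirling2 :: "real \<Rightarrow> (nat \<Rightarrow> nat \<Rightarrow> real) \<Rightarrow> bool" where
  "is_deg_stirling2 l S \<longleftrightarrow>
     (\<forall>n x. gen_ffact l x n = (\<Sum>k\<le>n. S n k * ffact x k)) \<and>
     (\<forall>n k. k > n \<longrightarrow> S n k = 0)"

text \<open>The unique existence needed for this definite description is \<open>ex1_deg_stirling2\<close> below.\<close>

definition deg_stirling2 :: "real \<Rightarrow> nat \<Rightarrow> nat \<Rightarrow> real" where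
  "deg_stirling2 l = (THE S. is_deg_stirling2 l S)"

lemma ffact_of_nat_eq_0: "k < j \<Longrightarrow> ffact (real k) j = 0"
  unfolding ffact_def by (rule prod_zero) auto

lemma ffact_of_nat_self_neq_0: "ffact (real k) k \<noteq> 0"
  unfolding ffact_def by simp

lemma ffact_lin_indep:
  assumes "\<And>x. (\<Sum>k\<le>n. c k * ffact x k) = 0" and "k \<le> n"
  shows "c k = 0"
  using assms(2)
proof (induction k rule: less_induct)
  case (less k)
  have "0 = (\<Sum>j\<le>n. c j * ffact (real k) j)"
    using assms(1) by simp
  also have "\<dots> = (\<Sum>j\<in>{k}. c j * ffact (real k) j)"
  proof (rule sum.mono_neutral_right)
    show "\<forall>i\<in>{..n} - {k}. c i * ffact (real k) i = 0"
      using less ffact_of_nat_eq_0 by (auto simp: neq_iff)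
  qed (use less in auto)
  finally show ?case
    using ffact_of_nat_self_neq_0[of k] by simp
qed

fun deg_stirling2_rec :: "real \<Rightarrow> nat \<Rightarrow> nat \<Rightarrow> real" where
  "deg_stirling2_rec l 0 k = (if k = 0 then 1 else 0)"
| "deg_stirling2_rec l (Suc n) k =
     (if k = 0 then 0 else deg_stirling2_rec l n (k - 1))
     + (real k - real n * l) * deg_stirling2_rec l n k"

lemma deg_stirling2_rec_eq_0: "k > n \<Longrightarrow> deg_stirling2_rec l n k = 0"
  by (induction n arbitrary: k) auto

lemma is_deg_stirling2_rec: "is_deg_stirling2 l (deg_stirling2_rec l)"
proof -
  let ?S = "deg_stirling2_rec l"
  have "gen_ffact l x n = (\<Sum>k\<le>n. ?S n k * ffact x k)" for n x
  proof (induction n)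
    case 0
    show ?case by (simp add: gen_ffact_def ffact_def)
  next
    case (Suc n)
    have "gen_ffact l x (Suc n) = (\<Sum>k\<le>n. ?S n k * ffact x k) * (x - real n * l)"
      using Suc by (simp add: gen_ffact_def)
    also have "\<dots> = (\<Sum>k\<le>n. ?S n k * ffact x (Suc k) + (real k - real n * l) * ?S n k * ffact x k)"
      unfolding sum_distrib_right
      by (intro sum.cong refl) (simp add: ffact_def algebra_simps)
    also have "\<dots> = (\<Sum>k\<le>n. ?S n k * ffact x (Suc k))
                  + (\<Sum>k\<le>n. (real k - real n * l) * ?S n k * ffact x k)"
      by (rule sum.distrib)
    also have "(\<Sum>k\<le>n. ?S n k * ffact x (Suc k))
                = (\<Sum>k\<le>Suc n. (if k = 0 then 0 else ?S n (k - 1)) * ffact x k)"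
      by (subst sum.atMost_Suc_shift) simp
    also have "(\<Sum>k\<le>n. (real k - real n * l) * ?S n k * ffact x k)
                = (\<Sum>k\<le>Suc n. (real k - real n * l) * ?S n k * ffact x k)"
      by (simp add: deg_stirling2_rec_eq_0)
    finally show ?case
      by (simp only: sum.distrib[symmetric] deg_stirling2_rec.simps distrib_right)
  qed
  then show ?thesis
    by (simp add: is_deg_stirling2_def deg_stirling2_rec_eq_0)
qed

lemma ex1_deg_stirling2: "\<exists>!S. is_deg_stirling2 l S"
proof (rule ex_ex1I)
  show "\<exists>S. is_deg_stirling2 l S"
    using is_deg_stirling2_rec by blast
next
  fix S T assume S: "is_deg_stirling2 l S" and T: "is_deg_stirling2 l T"
  have "S n k = T n k" for n k
  proof (cases "k \<le> n")
    case True
    have "(\<Sum>k\<le>n. (S n k - T n k) * ffact x k) = 0" for x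
      using S T unfolding is_deg_stirling2_def
      by (simp add: left_diff_distrib sum_subtractf)
    from ffact_lin_indep[of "\<lambda>k. S n k - T n k" n, OF this True] show ?thesis by simp
  next
    case False
    then show ?thesis using S T by (simp add: is_deg_stirling2_def)
  qed
  then show "S = T" by blast
qed

lemma is_deg_stirling2: "is_deg_stirling2 l (deg_stirling2 l)"
  unfolding deg_stirling2_def by (rule theI'[OF ex1_deg_stirling2])

end

theory Submission
  imports Defs
begin

text \<open>
  Write \<open>c\<^sub>k = S(n+1,k) + n \<lambda> S(n,k)\<close>. Since \<open>(x)\<^sub>n\<^sub>+\<^sub>1 = (x - n \<lambda>) (x)\<^sub>n\<close> for the generalized falling
  factorials, the \<open>c\<^sub>k\<close> are the coefficients of \<open>x (x)\<^sub>n\<close> in the basis of ordinary falling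
  factorials. At \<open>x = m + 1\<close> the \<open>k\<close>-th basis element is \<open>(m + 1) (k - 1)!\<close> times the binomial
  coefficient of \<open>m\<close> over \<open>k - 1\<close>; cancelling \<open>m + 1\<close> and summing over \<open>m\<close> with Pascal's rule
  evaluates the sum of the generalized falling factorials from \<open>1\<close> to \<open>m\<close>. The theorem is the
  difference of two such evaluations.
\<close>

lemma ffact_of_nat: "ffact (real n) k = fact k * real (n choose k)"
  unfolding ffact_def
  by (simp add: binomial_gbinomial gbinomial_prod_rev atLeast0LessThan)

lemma mult_gen_ffact:
  "x * gen_ffact l x n =
    (\<Sum>k\<le>Suc n. (deg_stirling2 l (n + 1) k + real n * l * deg_stirling2 l n k) * ffact x k)"
proof -
  have expand: "gen_ffact l x r = (\<Sum>k\<le>r. deg_stirling2 l r k * ffact x k)" for r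
    using is_deg_stirling2[of l] by (simp add: is_deg_stirling2_def)
  \<comment> \<open>This lets the expansion of degree \<open>n\<close> also run up to
    \<open>Suc n\<close>, so the two sums merge termwise.\<close>
  have vanish: "deg_stirling2 l n (Suc n) = 0"
    using is_deg_stirling2[of l] by (simp add: is_deg_stirling2_def)
  have "x * gen_ffact l x n = gen_ffact l x (Suc n) + real n * l * gen_ffact l x n"
    by (simp add: gen_ffact_def algebra_simps)
  also have "\<dots> = (\<Sum>k\<le>Suc n. deg_stirling2 l (Suc n) k * ffact x k)
      + real n * l * (\<Sum>k\<le>Suc n. deg_stirling2 l n k * ffact x k)"
    by (simp add: expand vanish)
  finally show ?thesis
    by (simp only: sum_distrib_left sum.distrib[symmetric] distrib_right mult.assoc Suc_eq_plus1)
qed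

lemma gen_ffact_of_Suc:
  "gen_ffact l (real (Suc m)) n =
    (\<Sum>k=1..Suc m. real (m choose (k - 1)) * fact (k - 1) *
      (deg_stirling2 l (n + 1) k + real n * l * deg_stirling2 l n k))"
proof -
  define c where "c k = deg_stirling2 l (n + 1) k + real n * l * deg_stirling2 l n k" for k
  have vanish: "c k = 0" if "k > Suc n" for k
    using is_deg_stirling2[of l] that by (simp add: is_deg_stirling2_def c_def)
  \<comment> \<open>At \<open>x = 0\<close> only the constant basis element survives, while
    \<open>x * gen_ffact l x n\<close> vanishes; hence \<open>c 0 = 0\<close>.\<close>
  have "ffact 0 (Suc k) = 0" for k
    using ffact_of_nat_eq_0[of 0 "Suc k"] by simp
  moreover have "ffact 0 0 = 1"
    by (simp add: ffact_def)
  ultimately have "c 0 = 0"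
    using mult_gen_ffact[of 0 l n] unfolding c_def[symmetric] sum.atMost_Suc_shift by simp
  have "real (Suc m) * gen_ffact l (real (Suc m)) n = (\<Sum>k\<le>Suc n. c k * ffact (real (Suc m)) k)"
    unfolding c_def by (rule mult_gen_ffact)
  \<comment> \<open>\<open>m\<close> and \<open>n\<close> are not ordered, so the range changes
    through a union: \<open>c k\<close> vanishes above \<open>Suc n\<close>, the falling factorial
    above \<open>Suc m\<close>.\<close>
  also have "\<dots> = (\<Sum>k\<in>{1..Suc m} \<union> {..Suc n}. c k * ffact (real (Suc m)) k)"
    by (rule sum.mono_neutral_left) (auto simp: vanish)
  also have "\<dots> = (\<Sum>k=1..Suc m. c k * ffact (real (Suc m)) k)"
  proof (rule sum.mono_neutral_right)
    show "\<forall>k\<in>{1..Suc m} \<union> {..Suc n} - {1..Suc m}. c k * ffact (real (Suc m)) k = 0"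
    proof
      fix k assume "k \<in> {1..Suc m} \<union> {..Suc n} - {1..Suc m}"
      then have "k = 0 \<or> Suc m < k" by auto
      then show "c k * ffact (real (Suc m)) k = 0"
        using \<open>c 0 = 0\<close> ffact_of_nat_eq_0[of "Suc m" k] by auto
    qed
  qed auto
  also have "\<dots> = (\<Sum>k=1..Suc m. real (Suc m) * (real (m choose (k - 1)) * fact (k - 1) * c k))"
  proof (rule sum.cong[OF refl])
    fix k assume "k \<in> {1..Suc m}"
    then obtain j where k: "k = Suc j" by (cases k) auto
    \<comment> \<open>Absorption extracts from every term the factor \<open>Suc m\<close>, which is
      nonzero and cancels at the end.\<close>
    have "real (Suc j) * real (Suc m choose Suc j) = real (Suc m) * real (m choose j)"
      unfolding of_nat_mult[symmetric] by (simp only: Suc_times_binomial_eq mult.commute)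
    then have "ffact (real (Suc m)) k = real (Suc m) * (real (m choose j) * fact j)"
      unfolding ffact_of_nat k fact_Suc
      by (metis mult.assoc mult.commute of_nat_fact of_nat_mult)
    then show "c k * ffact (real (Suc m)) k
        = real (Suc m) * (real (m choose (k - 1)) * fact (k - 1) * c k)"
      by (simp add: k)
  qed
  finally show ?thesis
    unfolding sum_distrib_left[symmetric] c_def by simp
qed

lemma sum_gen_ffact:
  "(\<Sum>k=1..m. gen_ffact l (real k) n) =
    (\<Sum>k=1..m. real (m choose k) * fact (k - 1) *
      (deg_stirling2 l (n + 1) k + real n * l * deg_stirling2 l n k))"
proof (induction m)
  case 0
  show ?case by simp
next
  case (Suc m)
  define w where "w k = fact (k - 1) *
      (deg_stirling2 l (n + 1) k + real n * l * deg_stirling2 l n k)" for k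
  have "(\<Sum>k=1..Suc m. real (Suc m choose k) * w k)
      = (\<Sum>k=1..Suc m. real (m choose (k - 1)) * w k + real (m choose k) * w k)"
  proof (rule sum.cong[OF refl])
    fix k assume "k \<in> {1..Suc m}"
    then obtain j where "k = Suc j" by (cases k) auto
    then show "real (Suc m choose k) * w k
        = real (m choose (k - 1)) * w k + real (m choose k) * w k"
      by (simp add: distrib_right)
  qed
  \<comment> \<open>The second sum loses its top term because \<open>m choose Suc m\<close> is 0.
    The first is the new summand, by \<open>gen_ffact_of_Suc\<close>.\<close>
  also have "\<dots> = (\<Sum>k=1..Suc m. real (m choose (k - 1)) * w k) + (\<Sum>k=1..m. real (m choose k) * w k)"
    by (simp add: sum.distrib)
  also have "\<dots> = gen_ffact l (real (Suc m)) n + (\<Sum>k=1..m. gen_ffact l (real k) n)"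
    unfolding gen_ffact_of_Suc Suc.IH w_def mult.assoc ..
  finally show ?case
    by (simp add: w_def mult.assoc)
qed

theorem theorem3:
  fixes l :: real and a m :: nat
  assumes "a \<ge> 1" and "m \<ge> a"
  shows "(\<Sum>k=a..m. gen_ffact l (real k) a) =
    (\<Sum>k=1..m. real (m choose k) * fact (k - 1) *
        (deg_stirling2 l (a + 1) k + real a * l * deg_stirling2 l a k))
    - (\<Sum>k=1..a-1. real ((a - 1) choose k) * fact (k - 1) *
        (deg_stirling2 l (a + 1) k + real a * l * deg_stirling2 l a k))"
proof -
  have "{1..m} = {1..a-1} \<union> {a..m}"
    using assms by auto
  then have "(\<Sum>k=1..m. gen_ffact l (real k) a)
      = (\<Sum>k=1..a-1. gen_ffact l (real k) a) + (\<Sum>k=a..m. gen_ffact l (real k) a)"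
    using assms by (simp add: sum.union_disjoint)
  then show ?thesis
    unfolding sum_gen_ffact by simp
qed

end
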